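(* Let $K$ be a field and $S=K[x_1,\dots,x_4]$. If $I$ is a squarefree monomial ideal of $S$, then $\operatorname{sdepth}(I)>\operatorname{sdepth}(S/I)$.
   Context: Stanley depth. Let $K$ be a field, $S=K[x_1,\dots,x_n]$ the polynomial ring over $K$ with its standard $\mathbb{Z}^n$-grading, and let $M$ be a $\mathbb{Z}^n$-graded $S$-module (here $n=4$ and $M=I$ or $M=S/I$ for a monomial ideal $I$). For a homogeneous element $m\in M$ and a subset $Z\subseteq\{x_1,\dots,x_n\}$, the $K[Z]$-submodule $mK[Z]$ of $M$ is called a Stanley space of $M$, of dimension $|Z|$, if it is a free $K[Z]$-submodule of $M$. A Stanley decomposition $\mathcal{D}$ of $M$ is a decomposition $M=\bigoplus_{j=1}^r m_jK[Z_j]$ of $M$ as a direct sum of $\mathbb{Z}^n$-graded $K$-vector spaces in which each $m_jK[Z_j]$ is a Stanley space of $M$. Put $\operatorname{sdepth}(\mathcal{D})=\min\{|Z_j| : j=1,\dots,r\}$, and let $\operatorname{sdepth}(M)$ be the maximum of $\operatorname{sdepth}(\mathcal{D})$ over all Stanley decompositions $\mathcal{D}$ of $M$. A squarefree monomial ideal is an ideal generated by squarefree monomials, that is, monomials in which every exponent is $0$ or $1$. *)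

theory Defs
  imports
    "HOL-Library.Poly_Mapping"
    "HOL-Library.Numeral_Type"
    "HOL-Library.Extended_Nat"
    "HOL-Algebra.QuotRing"
    "HOL-Algebra.Module"
    "HOL-Algebra.Algebraic_Closure_Type"
begin

text \<open>
  A polynomial is a finitely supported function from exponent vectors to coefficients; the
  variables are indexed by the type \<open>'n\<close>.
\<close>

type_synonym ('n, 'k) mpoly = "('n \<Rightarrow>\<^sub>0 nat) \<Rightarrow>\<^sub>0 'k"

abbreviation mpoly_ring :: "('n, 'k::field) mpoly ring"
  where "mpoly_ring \<equiv> ring_of_type_algebra"

definition polys_in :: "'n set \<Rightarrow> ('n, 'k::field) mpoly set"
  where "polys_in Z = {f. \<forall>t\<in>Poly_Mapping.keys f. Poly_Mapping.keys t \<subseteq> Z}"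

definition poly_component :: "('n \<Rightarrow> int) \<Rightarrow> ('n, 'k::field) mpoly set"
  where "poly_component a =
    {f. \<forall>t\<in>Poly_Mapping.keys f. \<forall>i. int (Poly_Mapping.lookup t i) = a i}"

definition squarefree_monomials :: "('n, 'k::field) mpoly set"
  where "squarefree_monomials =
    {Poly_Mapping.single t 1 | t. \<forall>i. Poly_Mapping.lookup t i \<le> 1}"

definition squarefree_monomial_ideal :: "('n, 'k::field) mpoly set \<Rightarrow> bool"
  where "squarefree_monomial_ideal I \<longleftrightarrow>
    (\<exists>G \<subseteq> squarefree_monomials. I = genideal mpoly_ring G)"


subsection \<open>Graded modules\<close>

text \<open>
  A module together with its homogeneous components, indexed by degrees in $Z^n$. As in the
  library's modules, the fields \<open>mult\<close> and \<open>one\<close> inherited from rings carry no meaning.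
\<close>

record ('a, 'b, 'n) graded_module = "('a, 'b) module" +
  component :: "('n \<Rightarrow> int) \<Rightarrow> 'b set"

definition ideal_module ::
  "('n, 'k::field) mpoly set \<Rightarrow> (('n, 'k) mpoly, ('n, 'k) mpoly, 'n) graded_module"
  where "ideal_module I =
    \<lparr>carrier = I, monoid.mult = (*), one = 1, zero = 0, add = (+),
     module.smult = (*),
     component = (\<lambda>a. I \<inter> poly_component a)\<rparr>"

text \<open>The elements of the quotient are the cosets of \<open>I\<close>.\<close>

definition quotient_module ::
  "('n, 'k::field) mpoly set \<Rightarrow> (('n, 'k) mpoly, ('n, 'k) mpoly set, 'n) graded_module"
  where "quotient_module I =
    (let Q = mpoly_ring Quot I in
    \<lparr>carrier = carrier Q, monoid.mult = monoid.mult Q, one = one Q, zero = zero Q, add = add Q,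
     module.smult = (\<lambda>f A. (I +>\<^bsub>mpoly_ring\<^esub> f) \<otimes>\<^bsub>Q\<^esub> A),
     component = (\<lambda>a. (\<lambda>f. I +>\<^bsub>mpoly_ring\<^esub> f) ` poly_component a)\<rparr>)"

lemma ring_of_type_algebra_simps [simp]:
  "carrier (ring_of_type_algebra :: 'a::ring_1 ring) = UNIV"
  "monoid.mult (ring_of_type_algebra :: 'a::ring_1 ring) = (*)"
  "one (ring_of_type_algebra :: 'a::ring_1 ring) = 1"
  "zero (ring_of_type_algebra :: 'a::ring_1 ring) = 0"
  "add (ring_of_type_algebra :: 'a::ring_1 ring) = (+)"
  by (simp_all add: ring_of_type_algebra_def)

lemma module_ideal_module:
  fixes I :: "('n, 'k::field) mpoly set"
  assumes "ideal I mpoly_ring"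
  shows "module mpoly_ring (ideal_module I)"
proof (rule moduleI)
  interpret ideal I mpoly_ring by fact
  have uminus: "- x \<in> I" if "x \<in> I" for x
    using I_l_closed[OF that, of "- 1"] by simp
  show "cring (mpoly_ring :: ('n, 'k) mpoly ring)"
    by (rule cring_from_type_algebra)
  show "abelian_group (ideal_module I)"
  proof (rule abelian_groupI, goal_cases)
    case 1 then show ?case using additive_subgroup.a_closed[OF is_additive_subgroup]
      by (simp add: ideal_module_def)
  next
    case 2 then show ?case using additive_subgroup.zero_closed[OF is_additive_subgroup]
      by (simp add: ideal_module_def)
  next
    case (6 x) then show ?case using uminus[of x]
      by (auto simp: ideal_module_def intro!: bexI[of _ "- x"])
  qed (simp_all add: ideal_module_def algebra_simps)
  show "a \<odot>\<^bsub>ideal_module I\<^esub> x \<in> carrier (ideal_module I)"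
    if "a \<in> carrier mpoly_ring" "x \<in> carrier (ideal_module I)" for a x
    using that I_l_closed[of x a] by (simp add: ideal_module_def)
qed (simp_all add: ideal_module_def algebra_simps)

lemma module_quotient_module:
  fixes I :: "('n, 'k::field) mpoly set"
  assumes "ideal I mpoly_ring"
  shows "module mpoly_ring (quotient_module I)"
proof -
  interpret ideal I mpoly_ring by fact
  interpret S: cring "mpoly_ring :: ('n, 'k) mpoly ring"
    by (rule cring_from_type_algebra)
  interpret Q: ring "mpoly_ring Quot I"
    by (rule quotient_is_ring)
  interpret h: ring_hom_ring mpoly_ring "mpoly_ring Quot I" "(+>\<^bsub>mpoly_ring\<^esub>) I"
    by (rule rcos_ring_hom_ring)
  show ?thesis
  proof (rule moduleI)
    show "cring (mpoly_ring :: ('n, 'k) mpoly ring)"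
      by (rule cring_from_type_algebra)
    show "abelian_group (quotient_module I)"
    proof (rule abelian_groupI, goal_cases)
      case (6 x) then show ?case
        using Q.l_neg[of x] Q.a_inv_closed[of x] by (auto simp: quotient_module_def Let_def)
    qed (simp_all add: quotient_module_def Let_def Q.add.m_ac)
  qed (use h.hom_mult h.hom_add h.hom_one in
      \<open>simp_all add: quotient_module_def Let_def Q.l_distr Q.r_distr Q.m_assoc\<close>)
qed


subsection \<open>Stanley depth\<close>

definition homogeneous :: "('a, 'b, 'n) graded_module \<Rightarrow> 'b \<Rightarrow> bool"
  where "homogeneous M m \<longleftrightarrow> (\<exists>a. m \<in> component M a)"

definition stanley_span ::
  "(('n, 'k::field) mpoly, 'b, 'n) graded_module \<Rightarrow> 'b \<Rightarrow> 'n set \<Rightarrow> 'b set"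
  where "stanley_span M m Z = (\<lambda>f. f \<odot>\<^bsub>M\<^esub> m) ` polys_in Z"

text \<open>
  Freeness means that the generator \<open>m\<close> is a basis over the polynomials in the variables \<open>Z\<close>;
  in particular \<open>m\<close> is nonzero.
\<close>

definition stanley_space ::
  "(('n, 'k::field) mpoly, 'b, 'n) graded_module \<Rightarrow> 'b \<Rightarrow> 'n set \<Rightarrow> bool"
  where "stanley_space M m Z \<longleftrightarrow>
    m \<in> carrier M \<and> homogeneous M m \<and>
    (\<forall>f\<in>polys_in Z. f \<odot>\<^bsub>M\<^esub> m = \<zero>\<^bsub>M\<^esub> \<longrightarrow> f = 0)"

text \<open>
  The spans of homogeneous elements are graded subspaces, so that a direct sum of them as
  abelian groups is one of graded vector spaces.
\<close>

definition stanley_decomposition ::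
  "(('n, 'k::field) mpoly, 'b, 'n) graded_module \<Rightarrow> ('b \<times> 'n set) list \<Rightarrow> bool"
  where "stanley_decomposition M D \<longleftrightarrow>
    (\<forall>(m, Z)\<in>set D. stanley_space M m Z) \<and>
    (\<forall>x\<in>carrier M.
      \<exists>!v. v \<in> (\<Pi>\<^sub>E j\<in>{..<length D}. stanley_span M (fst (D ! j)) (snd (D ! j))) \<and>
           x = (\<Oplus>\<^bsub>M\<^esub>j\<in>{..<length D}. v j))"

text \<open>
  Infimum and supremum are taken in \<open>enat\<close>. For a nonzero module they are the minimum of a
  nonempty finite set and the maximum of a set of numbers bounded by the number of variables.
  The zero module has only the empty decomposition and hence Stanley depth \<open>\<infinity>\<close>.
\<close>

definition sdepth_decomposition :: "('b \<times> 'n::finite set) list \<Rightarrow> enat"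
  where "sdepth_decomposition D = (INF (m, Z)\<in>set D. enat (card Z))"

definition sdepth :: "(('n::finite, 'k::field) mpoly, 'b, 'n) graded_module \<Rightarrow> enat"
  where "sdepth M = (SUP D\<in>{D. stanley_decomposition M D}. sdepth_decomposition D)"

end

theory Submission
  imports Defs
begin

text \<open>
  A squarefree monomial ideal \<open>I\<close> is determined by the family \<open>U\<close> of the supports of its
  monomials: \<open>U\<close> is closed under supersets, a polynomial lies in \<open>I\<close> iff the support of each of
  its monomials lies in \<open>U\<close>, and the sets outside \<open>U\<close> are the faces of a simplicial complex,
  nonempty because \<open>I\<close> is proper. Let \<open>d\<close> be the least cardinality of a facet (a maximal face).
  The number \<open>d\<close> separates the two Stanley depths: \<open>sdepth (S/I) \<le> d < sdepth I\<close>.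

  The first inequality (\<open>sdepth_quotient_le\<close>) holds for any number of variables. Let \<open>F\<close> be a
  facet. In a Stanley decomposition of \<open>S/I\<close>, some space \<open>m K[Z]\<close> contains a nonzero scalar
  multiple of the product \<open>x\<^sub>F\<close> of the variables in \<open>F\<close>, so \<open>F\<close> is contained in the union of \<open>Z\<close> and the
  support of \<open>m\<close>. As \<open>m K[Z]\<close> is free, this union is a face, hence equals \<open>F\<close>, and
  \<open>card Z \<le> card F\<close>.

  For the second inequality, a partition of \<open>U\<close> into intervals \<open>{A..B}\<close> gives a Stanley
  decomposition of \<open>I\<close>, because the monomials with support in \<open>{A..B}\<close> are a basis of
  \<open>x\<^sub>A K[B]\<close> (\<open>sdepth_ideal_ge\<close>). What remains is combinatorics on four points
  (\<open>interval_partition_four\<close>): if every facet has at least \<open>d\<close> elements, then \<open>U\<close> has a partition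
  into intervals whose upper ends have more than \<open>d\<close> elements. For \<open>d \<ge> 3\<close> the family \<open>U\<close> is
  empty or a single interval, which reflects that \<open>I\<close> is zero or principal. For \<open>d = 0\<close> the
  partition into one-element intervals works. For \<open>d = 1\<close> the vertices in \<open>U\<close> are matched with edges along a
  4-cycle. For \<open>d = 2\<close> a vertex in \<open>U\<close> is split off by an interval ending at the whole set, which
  leaves three points and an ideal that is zero or principal there; if \<open>U\<close> contains no vertex,
  the faces of size two form a graph without isolated points, which contains a perfect matching or
  a star, and in both cases the remaining pairs can be matched with triples.
\<close>

section \<open>Interval partitions of families closed under supersets\<close>

definition upset_in :: "'a set \<Rightarrow> 'a set set \<Rightarrow> bool"
  where "upset_in V U \<longleftrightarrow> U \<subseteq> Pow V \<and> (\<forall>A\<in>U. \<forall>B\<subseteq>V. A \<subseteq> B \<longrightarrow> B \<in> U)"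

text \<open>
  The pair \<open>(A, B)\<close> stands for the interval \<open>{A..B}\<close> of the inclusion order; the condition
  \<open>A \<subseteq> B\<close> makes distinct pairs stand for distinct intervals.
\<close>

definition interval_partition :: "('a set \<times> 'a set) set \<Rightarrow> 'a set set \<Rightarrow> bool"
  where "interval_partition P U \<longleftrightarrow>
    (\<forall>(A, B)\<in>P. A \<subseteq> B) \<and> (\<Union>(A, B)\<in>P. {A..B}) = U \<and>
    (\<forall>p\<in>P. \<forall>q\<in>P. p \<noteq> q \<longrightarrow> {fst p..snd p} \<inter> {fst q..snd q} = {})"

text \<open>
  The subsets of \<open>V\<close> outside \<open>U\<close> are thought of as the faces of a simplicial complex. The
  condition says that every facet of it has at least \<open>d\<close> elements, in a form that avoids facets.
\<close>

definition large_faces :: "nat \<Rightarrow> 'a set \<Rightarrow> 'a set set \<Rightarrow> bool"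
  where "large_faces d V U \<longleftrightarrow>
    (\<forall>F\<subseteq>V. F \<notin> U \<longrightarrow> (\<exists>F'. F \<subseteq> F' \<and> F' \<subseteq> V \<and> F' \<notin> U \<and> d \<le> card F'))"

lemma upset_inD: "upset_in V U \<Longrightarrow> A \<in> U \<Longrightarrow> A \<subseteq> B \<Longrightarrow> B \<subseteq> V \<Longrightarrow> B \<in> U"
  unfolding upset_in_def by blast

lemma upset_in_subset: "upset_in V U \<Longrightarrow> A \<in> U \<Longrightarrow> A \<subseteq> V"
  unfolding upset_in_def by blast

text \<open>
  The elements of the least possible cardinality \<open>k\<close> are the only ones that are too small to be upper
  ends. Once they are matched with distinct elements of \<open>U\<close> one size larger, the matched pairs form
  two-element intervals and everything else can be left as one-element intervals.
\<close>

lemma interval_partition_matching: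
  assumes V: "finite V" and U: "upset_in V U"
    and k: "\<And>A. A \<in> U \<Longrightarrow> k \<le> card A"
    and inj: "inj_on \<phi> {A \<in> U. card A = k}"
    and \<phi>: "\<And>A. A \<in> U \<Longrightarrow> card A = k \<Longrightarrow> \<exists>x\<in>V - A. \<phi> A = insert x A"
  shows "\<exists>P. interval_partition P U \<and> (\<forall>(A, B)\<in>P. k < card B)"
proof -
  define M where "M = {A \<in> U. card A = k}"
  define P where "P = (\<lambda>A. (A, \<phi> A)) ` M \<union> (\<lambda>A. (A, A)) ` (U - M - \<phi> ` M)"
  have fin: "finite A" if "A \<in> U" for A
  proof -
    have "A \<subseteq> V" using upset_in_subset[OF U that] .
    then show ?thesis using V by (rule finite_subset)
  qed
  have pair: "{A..\<phi> A} = {A, \<phi> A}" "A \<subseteq> \<phi> A" "\<phi> A \<in> U" "card (\<phi> A) = Suc k" if "A \<in> M" for A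
  proof -
    have A: "A \<in> U" "card A = k" using that M_def by auto
    obtain x where x: "x \<in> V - A" "\<phi> A = insert x A" using \<phi>[OF A] by blast
    have "C = A \<or> C = insert x A" if "A \<subseteq> C" "C \<subseteq> insert x A" for C
    proof (cases "x \<in> C")
      case True
      then show ?thesis using that by (intro disjI2 equalityI) simp_all
    next
      case False
      then have "C \<subseteq> A" using that(2) by (simp add: subset_insert)
      then show ?thesis using that(1) by (intro disjI1 equalityI)
    qed
    then have eq: "C \<in> {A..insert x A} \<longleftrightarrow> C \<in> {A, insert x A}" for C
      unfolding atLeastAtMost_iff insert_iff[of C] empty_iff
      by (metis order_refl subset_insertI)
    show "{A..\<phi> A} = {A, \<phi> A}" unfolding x(2) by (rule Set.set_eqI) (rule eq)
    show "A \<subseteq> \<phi> A" unfolding x(2) by blast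
    have "insert x A \<subseteq> V" using upset_in_subset[OF U A(1)] x(1) by blast
    then show "\<phi> A \<in> U" unfolding x(2) using upset_inD[OF U A(1)] by blast
    show "card (\<phi> A) = Suc k" unfolding x(2) using x(1) A fin[of A] by simp
  qed
  have new: "\<phi> A \<notin> M" if "A \<in> M" for A
    using pair(4)[OF that] unfolding M_def by auto
  have "interval_partition P U"
    unfolding interval_partition_def
  proof (intro conjI)
    show "\<forall>(A, B)\<in>P. A \<subseteq> B" using pair(2) unfolding P_def by auto
    show "(\<Union>(A, B)\<in>P. {A..B}) = U"
    proof -
      have "(\<Union>(A, B)\<in>P. {A..B}) = (\<Union>A\<in>M. {A, \<phi> A}) \<union> (U - M - \<phi> ` M)"
        unfolding P_def using pair(1) by auto
      also have "\<dots> = U" using pair(3) unfolding M_def by auto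
      finally show ?thesis .
    qed
    show "\<forall>p\<in>P. \<forall>q\<in>P. p \<noteq> q \<longrightarrow> {fst p..snd p} \<inter> {fst q..snd q} = {}"
    proof (intro ballI impI)
      fix p q assume pq: "p \<in> P" "q \<in> P" "p \<noteq> q"
      have ends: "{fst p..snd p} = {fst p, snd p} \<and>
          (fst p \<in> M \<and> snd p = \<phi> (fst p) \<or> fst p \<in> U - M - \<phi> ` M \<and> snd p = fst p)"
        if "p \<in> P" for p
        using that pair(1) unfolding P_def by auto
      have "fst p \<noteq> fst q" using ends[OF pq(1)] ends[OF pq(2)] pq(3) by (metis DiffD1 DiffD2 prod_eqI)
      then show "{fst p..snd p} \<inter> {fst q..snd q} = {}"
        using ends[OF pq(1)] ends[OF pq(2)] new inj_onD[OF inj[folded M_def], of "fst p" "fst q"]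
        by auto
    qed
  qed
  moreover have "\<forall>(A, B)\<in>P. k < card B"
  proof -
    have "k < card A" if "A \<in> U - M" for A
      using that k[of A] unfolding M_def by auto
    then show ?thesis unfolding P_def using pair(4) by auto
  qed
  ultimately show ?thesis by blast
qed

text \<open>
  All supersets of a point \<open>w\<close> with \<open>{w} \<in> U\<close> form one interval with the largest possible upper
  end; the rest of \<open>U\<close> lives on the smaller ground set \<open>V - {w}\<close>.
\<close>

lemma interval_partition_cone:
  assumes U: "upset_in V U" and w: "{w} \<in> U"
    and P: "interval_partition P {A \<in> U. A \<subseteq> V - {w}}"
  shows "interval_partition (insert ({w}, V) P) U"
proof -
  have "w \<in> V" using upset_in_subset[OF U w] by blast
  have B: "{A..B} \<subseteq> {A \<in> U. A \<subseteq> V - {w}}" if "(A, B) \<in> P" for A B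
    using P that unfolding interval_partition_def by blast
  have sub: "\<forall>(A, B)\<in>insert ({w}, V) P. A \<subseteq> B"
    using P \<open>w \<in> V\<close> unfolding interval_partition_def by auto
  have un: "(\<Union>(A, B)\<in>insert ({w}, V) P. {A..B}) = {{w}..V} \<union> {A \<in> U. A \<subseteq> V - {w}}"
    using P unfolding interval_partition_def by simp
  have eq: "{{w}..V} \<union> {A \<in> U. A \<subseteq> V - {w}} = U"
    using upset_inD[OF U w] upset_in_subset[OF U] w by auto
  have dj: "{{w}..V} \<inter> {A..B} = {}" if "(A, B) \<in> P" for A B
  proof (rule ccontr)
    assume "{{w}..V} \<inter> {A..B} \<noteq> {}"
    then obtain C where C: "C \<in> {{w}..V}" "C \<in> {A..B}" by blast
    then have "C \<subseteq> V - {w}" using B[OF that] by blast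
    then show False using C(1) by auto
  qed
  have old: "\<forall>p\<in>P. \<forall>q\<in>P. p \<noteq> q \<longrightarrow> {fst p..snd p} \<inter> {fst q..snd q} = {}"
    using P unfolding interval_partition_def by blast
  show ?thesis
    unfolding interval_partition_def
  proof (intro conjI)
    show "\<forall>(A, B)\<in>insert ({w}, V) P. A \<subseteq> B" by (rule sub)
    show "(\<Union>(A, B)\<in>insert ({w}, V) P. {A..B}) = U" unfolding un by (rule eq)
    show "\<forall>p\<in>insert ({w}, V) P. \<forall>q\<in>insert ({w}, V) P.
      p \<noteq> q \<longrightarrow> {fst p..snd p} \<inter> {fst q..snd q} = {}"
      using old dj by (metis Int_commute fst_conv insert_iff prod.collapse snd_conv)
  qed
qed

lemma upset_in_deletion:
  "upset_in V U \<Longrightarrow> upset_in (V - W) {A \<in> U. A \<subseteq> V - W}"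
  using upset_inD[of V U] unfolding upset_in_def[of "V - W"] by blast

text \<open>
  A face never contains a point \<open>w\<close> with \<open>{w} \<in> U\<close>, so that removing \<open>w\<close> from the ground set
  does not change the faces.
\<close>

lemma large_faces_deletion:
  assumes "upset_in V U" "{w} \<in> U" "large_faces d V U"
  shows "large_faces d (V - {w}) {A \<in> U. A \<subseteq> V - {w}}"
  unfolding large_faces_def
proof (intro allI impI)
  fix F assume F: "F \<subseteq> V - {w}" "F \<notin> {A \<in> U. A \<subseteq> V - {w}}"
  then have "F \<subseteq> V" "F \<notin> U" by auto
  then obtain F' where F': "F \<subseteq> F'" "F' \<subseteq> V" "F' \<notin> U" "d \<le> card F'"
    using assms(3)[unfolded large_faces_def, rule_format, of F] by blast
  have "w \<notin> F'" using upset_inD[OF assms(1,2), of F'] F' by blast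
  then show "\<exists>F'. F \<subseteq> F' \<and> F' \<subseteq> V - {w} \<and> F' \<notin> {A \<in> U. A \<subseteq> V - {w}} \<and> d \<le> card F'"
    using F' by blast
qed

text \<open>
  When every facet misses at most one point and \<open>V\<close> is not itself a face, the facets are the sets
  \<open>V - {i}\<close> for \<open>i\<close> in some set \<open>G\<close>, and lying in no facet means containing \<open>G\<close>. This is the case
  of an ideal that is zero or generated by one monomial.
\<close>

lemma interval_partition_codim_one:
  assumes V: "finite V" and U: "upset_in V U" and d: "large_faces d V U" "card V \<le> d + 1"
    and empty: "{} \<notin> U"
  shows "\<exists>P. interval_partition P U \<and> (\<forall>(A, B)\<in>P. d < card B)"
proof (cases "V \<in> U")
  case False
  then have "U = {}" using upset_inD[OF U] upset_in_subset[OF U] by blast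
  then have "interval_partition {} U" by (simp add: interval_partition_def)
  then show ?thesis by blast
next
  case True
  define G where "G = {i \<in> V. V - {i} \<notin> U}"
  have "C \<in> U \<longleftrightarrow> G \<subseteq> C \<and> C \<subseteq> V" for C
  proof
    assume C: "C \<in> U"
    have "i \<in> C" if "i \<in> G" for i
      using upset_inD[OF U C, of "V - {i}"] upset_in_subset[OF U C] that unfolding G_def by blast
    then show "G \<subseteq> C \<and> C \<subseteq> V" using upset_in_subset[OF U C] by blast
  next
    assume C: "G \<subseteq> C \<and> C \<subseteq> V"
    show "C \<in> U"
    proof (rule ccontr)
      assume "C \<notin> U"
      then obtain F where F: "C \<subseteq> F" "F \<subseteq> V" "F \<notin> U" "d \<le> card F"
        using C d(1)[unfolded large_faces_def, rule_format, of C] by blast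
      have "F \<noteq> V" using F(3) True by blast
      then obtain i where i: "i \<in> V" "i \<notin> F" using F(2) by blast
      have "F \<subseteq> V - {i}" using F i by blast
      moreover have "card (V - {i}) \<le> card F" using i d F V by simp
      ultimately have "F = V - {i}" using V by (meson card_seteq finite_Diff)
      then have "i \<in> G" using F i unfolding G_def by blast
      then show False using C F i by blast
    qed
  qed
  then have eq: "{G..V} = U" by auto
  have "interval_partition {(G, V)} U"
    unfolding interval_partition_def using eq by (auto simp: G_def)
  moreover have "d < card V"
  proof -
    obtain F where F: "F \<subseteq> V" "F \<notin> U" "d \<le> card F"
      using d(1)[unfolded large_faces_def, rule_format, of "{}"] empty by blast
    then have "F \<subset> V" using True by blast
    then show ?thesis using F(3) V psubset_card_mono le_less_trans by blast
  qed
  ultimately show ?thesis by blast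
qed


section \<open>Interval partitions on four points\<close>

lemma large_faces_edge:
  assumes "large_faces 2 V U" "finite V" "upset_in V U" "x \<in> V" "{x} \<notin> U"
  shows "\<exists>y\<in>V - {x}. {x, y} \<notin> U"
proof -
  obtain F where F: "{x} \<subseteq> F" "F \<subseteq> V" "F \<notin> U" "2 \<le> card F"
    using assms(1)[unfolded large_faces_def, rule_format, of "{x}"] assms(4,5) by blast
  then have "F \<noteq> {x}" by auto
  then obtain y where "y \<in> F" "y \<noteq> x" using F by blast
  moreover then have "{x, y} \<notin> U"
    using upset_inD[OF assms(3), of "{x, y}" F] F by blast
  ultimately show ?thesis using F by blast
qed

lemma card_ge_1_upset:
  assumes "finite V" "upset_in V U" "{} \<notin> U" "A \<in> U"
  shows "1 \<le> card A"
proof -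
  have "A \<subseteq> V" by (rule upset_in_subset[OF assms(2,4)])
  then have "finite A" using assms(1) by (rule finite_subset)
  moreover have "A \<noteq> {}" using assms(3,4) by blast
  ultimately show ?thesis by (simp add: Suc_le_eq card_gt_0_iff)
qed

lemma card_ge_2_upset:
  assumes "finite V" "upset_in V U" "{} \<notin> U" "\<And>x. {x} \<notin> U" "A \<in> U"
  shows "2 \<le> card A"
proof -
  have "card A \<noteq> 1" using assms(4,5) by (auto simp: card_1_singleton_iff)
  then show ?thesis using card_ge_1_upset[OF assms(1,2,3,5)] by linarith
qed

lemma pairs_of_four:
  assumes V: "V = {a, b, c, d}" and A: "A \<subseteq> V" "card A = 2"
  shows "A \<in> {{a, b}, {b, c}, {c, d}, {d, a}, {a, c}, {b, d}}"
proof -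
  obtain x y where "A = {x, y}" "x \<noteq> y" using A(2) by (auto simp: card_2_iff)
  then have "x \<in> {a, b, c, d}" "y \<in> {a, b, c, d}" using A(1) V by auto
  then show ?thesis
    unfolding \<open>A = {x, y}\<close> using \<open>x \<noteq> y\<close>
    by (elim insertE emptyE) (simp_all add: insert_commute)
qed

text \<open>
  The two faces \<open>{a, c}\<close> and \<open>{b, d}\<close> form a perfect matching. The other pairs are the edges of
  the cycle \<open>a, b, c, d\<close>, and each is matched with the triple obtained by adding the next point of
  the cycle.
\<close>

lemma interval_partition_four_cycle:
  assumes V: "V = {a, b, c, d}" "distinct [a, b, c, d]"
    and U: "upset_in V U" and k: "\<And>A. A \<in> U \<Longrightarrow> 2 \<le> card A"
    and faces: "{a, c} \<notin> U" "{b, d} \<notin> U"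
  shows "\<exists>P. interval_partition P U \<and> (\<forall>(A, B)\<in>P. 2 < card B)"
proof -
  define \<phi> where "\<phi> A = (if A = {a, b} then {a, b, c} else if A = {b, c} then {b, c, d}
    else if A = {c, d} then {c, d, a} else {d, a, b})" for A
  have neq: "a \<noteq> b" "a \<noteq> c" "a \<noteq> d" "b \<noteq> c" "b \<noteq> d" "c \<noteq> d" using V(2) by auto
  have vals: "\<phi> {a, b} = {a, b, c}" "\<phi> {b, c} = {b, c, d}" "\<phi> {c, d} = {c, d, a}"
    "\<phi> {d, a} = {d, a, b}"
    using neq unfolding \<phi>_def by (simp_all add: doubleton_eq_iff)
  have triples: "{a, b, c} \<noteq> {b, c, d}" "{a, b, c} \<noteq> {c, d, a}" "{a, b, c} \<noteq> {d, a, b}"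
    "{b, c, d} \<noteq> {c, d, a}" "{b, c, d} \<noteq> {d, a, b}" "{c, d, a} \<noteq> {d, a, b}"
    using neq by blast+
  have M: "A \<in> {{a, b}, {b, c}, {c, d}, {d, a}}" if "A \<in> U" "card A = 2" for A
    using pairs_of_four[OF V(1) upset_in_subset[OF U]] that faces by blast
  show ?thesis
  proof (rule interval_partition_matching)
    show "finite V" using V by simp
    show "upset_in V U" by fact
    show "2 \<le> card A" if "A \<in> U" for A using k that .
    have "inj_on \<phi> {{a, b}, {b, c}, {c, d}, {d, a}}"
    proof (rule inj_onI)
      fix A B assume "A \<in> {{a, b}, {b, c}, {c, d}, {d, a}}" "B \<in> {{a, b}, {b, c}, {c, d}, {d, a}}"
        "\<phi> A = \<phi> B"
      then show "A = B"
        by (elim insertE emptyE; hypsubst; simp add: vals triples triples[symmetric])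
    qed
    then show "inj_on \<phi> {A \<in> U. card A = 2}"
      by (rule inj_on_subset) (use M in blast)
    show "\<exists>x\<in>V - A. \<phi> A = insert x A" if "A \<in> U" "card A = 2" for A
    proof -
      have "A = {a, b} \<or> A = {b, c} \<or> A = {c, d} \<or> A = {d, a}" using M[OF that] by simp
      then consider "A = {a, b}" | "A = {b, c}" | "A = {c, d}" | "A = {d, a}" by argo
      then show ?thesis
      proof cases
        case 1 show ?thesis unfolding 1 vals V(1) using neq by (intro bexI[of _ c]) auto
      next
        case 2 show ?thesis unfolding 2 vals V(1) using neq by (intro bexI[of _ d]) auto
      next
        case 3 show ?thesis unfolding 3 vals V(1) using neq by (intro bexI[of _ a]) auto
      next
        case 4 show ?thesis unfolding 4 vals V(1) using neq by (intro bexI[of _ b]) auto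
      qed
    qed
  qed
qed

text \<open>
  The three faces form a star with centre \<open>d\<close>. The other pairs lie in \<open>{a, b, c}\<close>, so that adding
  \<open>d\<close> to them is injective.
\<close>

lemma interval_partition_four_star:
  assumes V: "V = {a, b, c, d}" "distinct [a, b, c, d]"
    and U: "upset_in V U" and k: "\<And>A. A \<in> U \<Longrightarrow> 2 \<le> card A"
    and faces: "{a, d} \<notin> U" "{b, d} \<notin> U" "{c, d} \<notin> U"
  shows "\<exists>P. interval_partition P U \<and> (\<forall>(A, B)\<in>P. 2 < card B)"
proof -
  have M: "A \<in> {{a, b}, {b, c}, {a, c}}" if "A \<in> U" "card A = 2" for A
    using pairs_of_four[OF V(1) upset_in_subset[OF U]] that faces
    by (auto simp: insert_commute)
  show ?thesis
  proof (rule interval_partition_matching)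
    show "finite V" using V by simp
    show "upset_in V U" by fact
    show "2 \<le> card A" if "A \<in> U" for A using k that .
    have "inj_on (insert d) {{a, b}, {b, c}, {a, c}}"
      using V(2) by (auto simp: inj_on_def)
    then show "inj_on (insert d) {A \<in> U. card A = 2}"
      by (rule inj_on_subset) (use M in blast)
    show "\<exists>x\<in>V - A. insert d A = insert x A" if "A \<in> U" "card A = 2" for A
      using M[OF that] V by auto
  qed
qed

text \<open>
  The combinatorial core. The number four enters for \<open>d = 2\<close>: a graph without isolated points on
  four points contains two disjoint edges or all three edges at some point.
\<close>

lemma interval_partition_four:
  assumes V: "card V = 4" and U: "upset_in V U" "{} \<notin> U" and d: "large_faces d V U"
  shows "\<exists>P. interval_partition P U \<and> (\<forall>(A, B)\<in>P. d < card B)"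
proof -
  have fin: "finite V" by (rule card_ge_0_finite) (simp add: V)
  obtain a b c e where V4: "V = {a, b, c, e}" "distinct [a, b, c, e]"
  proof -
    obtain a W where W: "V = insert a W" "a \<notin> W" "card W = 3"
      using V card_eq_SucD[of V 3] by auto
    obtain b c e where "W = {b, c, e}" "b \<noteq> c" "c \<noteq> e" "b \<noteq> e"
      using W(3) unfolding card_3_iff by blast
    then show ?thesis using that[of a b c e] W by simp
  qed
  consider "d = 0" | "d = 1" | "d = 2" | "card V \<le> d + 1" using V by linarith
  then show ?thesis
  proof cases
    case 1
    have "interval_partition ((\<lambda>A. (A, A)) ` U) U"
      by (auto simp: interval_partition_def)
    moreover have "0 < card A" if "A \<in> U" for A
      using card_ge_1_upset[OF fin U that] by simp
    ultimately show ?thesis using 1 by blast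
  next
    case 2
    \<comment> \<open>The vertices in \<open>U\<close> are matched with the edges of the cycle \<open>a, b, c, e\<close>.\<close>
    define \<phi> where "\<phi> A = (if A = {a} then {a, b} else if A = {b} then {b, c}
      else if A = {c} then {c, e} else {e, a})" for A
    have M: "A \<in> {{a}, {b}, {c}, {e}}" if "A \<in> U" "card A = 1" for A
      using that upset_in_subset[OF U(1) that(1)] V4(1) by (auto simp: card_1_singleton_iff)
    show ?thesis unfolding 2
    proof (rule interval_partition_matching[OF fin U(1)])
      show "1 \<le> card A" if "A \<in> U" for A using card_ge_1_upset[OF fin U that] .
      have "inj_on \<phi> {{a}, {b}, {c}, {e}}"
        unfolding \<phi>_def using V4(2) by (auto simp: inj_on_def doubleton_eq_iff)
      then show "inj_on \<phi> {A \<in> U. card A = 1}"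
        by (rule inj_on_subset) (use M in blast)
      show "\<exists>x\<in>V - A. \<phi> A = insert x A" if "A \<in> U" "card A = 1" for A
        using M[OF that] V4(2) unfolding \<phi>_def V4(1) by (auto simp: insert_commute)
    qed
  next
    case 3
    show ?thesis
    proof (cases "\<exists>w. {w} \<in> U")
      case True
      then obtain w where w: "{w} \<in> U" by blast
      then have "w \<in> V" using upset_in_subset[OF U(1)] by blast
      \<comment> \<open>On the three points other than \<open>w\<close>, every facet misses at most one point.\<close>
      define U' where "U' = {A \<in> U. A \<subseteq> V - {w}}"
      have "\<exists>P. interval_partition P U' \<and> (\<forall>(A, B)\<in>P. 2 < card B)"
      proof (rule interval_partition_codim_one)
        show "finite (V - {w})" using fin by simp
        show "upset_in (V - {w}) U'" unfolding U'_def by (rule upset_in_deletion[OF U(1)])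
        show "large_faces 2 (V - {w}) U'"
          unfolding U'_def using large_faces_deletion[OF U(1) w d] 3 by simp
        show "card (V - {w}) \<le> 2 + 1" using V \<open>w \<in> V\<close> by simp
        show "{} \<notin> U'" using U(2) U'_def by blast
      qed
      then obtain P where P: "interval_partition P U'" "\<forall>(A, B)\<in>P. 2 < card B" by blast
      have "interval_partition (insert ({w}, V) P) U"
        using interval_partition_cone[OF U(1) w] P(1) U'_def by simp
      moreover have "\<forall>(A, B)\<in>insert ({w}, V) P. d < card B" using P(2) V 3 by auto
      ultimately show ?thesis by blast
    next
      case False
      have k: "2 \<le> card A" if "A \<in> U" for A
        using card_ge_2_upset[OF fin U _ that] False by blast
      have edge: "\<exists>y\<in>V - {x}. {x, y} \<notin> U" if "x \<in> V" for x
        using large_faces_edge[OF _ fin U(1) that] d 3 False by blast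
      have cyc: ?thesis if "V = {p, q, r, s}" "distinct [p, q, r, s]"
        "{p, r} \<notin> U" "{q, s} \<notin> U" for p q r s
        using interval_partition_four_cycle[OF that(1,2) U(1) k that(3,4)] 3 by blast
      have star: ?thesis if "V = {p, q, r, s}" "distinct [p, q, r, s]"
        "{p, s} \<notin> U" "{q, s} \<notin> U" "{r, s} \<notin> U" for p q r s
        using interval_partition_four_star[OF that(1,2) U(1) k that(3-5)] 3 by blast
      have neq: "a \<noteq> b" "a \<noteq> c" "a \<noteq> e" "b \<noteq> c" "b \<noteq> e" "c \<noteq> e" using V4(2) by auto
      \<comment> \<open>No point is isolated in the graph of faces of size two, so this graph contains one of the
        three perfect matchings or one of the four stars.\<close>
      have "{a, b} \<notin> U \<or> {a, c} \<notin> U \<or> {a, e} \<notin> U" "{a, b} \<notin> U \<or> {b, c} \<notin> U \<or> {b, e} \<notin> U"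
        "{a, c} \<notin> U \<or> {b, c} \<notin> U \<or> {c, e} \<notin> U" "{a, e} \<notin> U \<or> {b, e} \<notin> U \<or> {c, e} \<notin> U"
        using edge[of a] edge[of b] edge[of c] edge[of e] neq unfolding V4(1)
        by (auto simp: insert_commute)
      then consider "{a, c} \<notin> U" "{b, e} \<notin> U" | "{a, b} \<notin> U" "{c, e} \<notin> U"
        | "{a, e} \<notin> U" "{b, c} \<notin> U"
        | "{a, e} \<notin> U" "{b, e} \<notin> U" "{c, e} \<notin> U" | "{a, c} \<notin> U" "{b, c} \<notin> U" "{c, e} \<notin> U"
        | "{a, b} \<notin> U" "{b, c} \<notin> U" "{b, e} \<notin> U" | "{a, b} \<notin> U" "{a, c} \<notin> U" "{a, e} \<notin> U"
        by blast
      then show ?thesis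
      proof cases
        case 1 then show ?thesis using cyc[of a b c e] V4 by blast
      next
        case 2 then show ?thesis using cyc[of a c b e] V4 by (auto simp: insert_commute)
      next
        case 3 then show ?thesis using cyc[of a b e c] V4 by (auto simp: insert_commute)
      next
        case 4 then show ?thesis using star[of a b c e] V4 by blast
      next
        case 5 then show ?thesis using star[of a b e c] V4 by (auto simp: insert_commute)
      next
        case 6 then show ?thesis using star[of a c e b] V4 by (auto simp: insert_commute)
      next
        case 7 then show ?thesis using star[of b c e a] V4 by (auto simp: insert_commute)
      qed
    qed
  next
    case 4
    then show ?thesis using interval_partition_codim_one[OF fin U(1) d _ U(2)] by blast
  qed
qed


section \<open>Polynomials with prescribed supports\<close>

definition supported_in :: "'n set set \<Rightarrow> ('n, 'k::field) mpoly set"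
  where "supported_in \<C> = {f. \<forall>t\<in>Poly_Mapping.keys f. Poly_Mapping.keys t \<in> \<C>}"

definition squarefree_exponent :: "'n::finite set \<Rightarrow> 'n \<Rightarrow>\<^sub>0 nat"
  where "squarefree_exponent A = (\<Sum>i\<in>A. Poly_Mapping.single i 1)"

lemma lookup_squarefree_exponent:
  "Poly_Mapping.lookup (squarefree_exponent A) i = (if i \<in> A then 1 else 0)"
  by (simp add: squarefree_exponent_def lookup_sum lookup_single when_def)

lemma keys_squarefree_exponent [simp]: "Poly_Mapping.keys (squarefree_exponent A) = A"
  by (auto simp: in_keys_iff lookup_squarefree_exponent split: if_splits)

lemma keys_exponent_add:
  fixes s t :: "'n \<Rightarrow>\<^sub>0 nat"
  shows "Poly_Mapping.keys (s + t) = Poly_Mapping.keys s \<union> Poly_Mapping.keys t"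
  by (auto simp: in_keys_iff lookup_add)

lemma exponent_diff_add:
  assumes "\<forall>i. Poly_Mapping.lookup s i \<le> 1" "Poly_Mapping.keys s \<subseteq> Poly_Mapping.keys t"
  shows "t - s + s = (t :: 'n \<Rightarrow>\<^sub>0 nat)"
proof (rule poly_mapping_eqI)
  fix i
  have "Poly_Mapping.lookup s i \<le> Poly_Mapping.lookup t i"
  proof (cases "i \<in> Poly_Mapping.keys s")
    case True
    then have "i \<in> Poly_Mapping.keys t" using assms(2) by blast
    then have "Poly_Mapping.lookup t i \<noteq> 0" by (simp add: in_keys_iff)
    then show ?thesis using assms(1)[rule_format, of i] by linarith
  qed (simp add: in_keys_iff)
  then show "Poly_Mapping.lookup (t - s + s) i = Poly_Mapping.lookup t i"
    by (simp add: lookup_add lookup_minus)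
qed

lemma sum_terms:
  "(\<Sum>t\<in>Poly_Mapping.keys f. Poly_Mapping.single t (Poly_Mapping.lookup f t)) = f"
  by (rule poly_mapping_eqI)
    (auto simp: lookup_sum lookup_single when_def in_keys_iff)

text \<open>
  Multiplication by a monomial shifts coefficients; in particular it is injective.
\<close>

lemma lookup_mult_monomial:
  fixes f :: "('n, 'k::field) mpoly"
  shows "Poly_Mapping.lookup (f * Poly_Mapping.single s 1) (t + s) = Poly_Mapping.lookup f t"
proof -
  have "f * Poly_Mapping.single s 1 =
    (\<Sum>t\<in>Poly_Mapping.keys f. Poly_Mapping.single (t + s) (Poly_Mapping.lookup f t))"
    by (subst (1) sum_terms[of f, symmetric]) (simp add: sum_distrib_right mult_single)
  then show ?thesis
    by (auto simp: lookup_sum lookup_single when_def in_keys_iff)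
qed

lemma supported_in_add: "f \<in> supported_in \<C> \<Longrightarrow> g \<in> supported_in \<C> \<Longrightarrow> f + g \<in> supported_in \<C>"
  using keys_add[of f g] unfolding supported_in_def by blast

lemma supported_in_mult:
  fixes f g :: "('n, 'k::field) mpoly"
  assumes U: "upset_in UNIV U" and "f \<in> supported_in U"
  shows "g * f \<in> supported_in U"
  unfolding supported_in_def
proof safe
  fix t assume "t \<in> Poly_Mapping.keys (g * f)"
  then obtain a b where "t = a + b" "b \<in> Poly_Mapping.keys f" using keys_mult[of g f] by blast
  then show "Poly_Mapping.keys t \<in> U"
    using assms unfolding supported_in_def
    by (auto simp: keys_exponent_add intro: upset_inD[OF U])
qed

lemma ideal_supported_in:
  assumes U: "upset_in UNIV U"
  shows "ideal (supported_in U :: ('n, 'k::field) mpoly set) mpoly_ring"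
proof (rule idealI)
  let ?I = "supported_in U :: ('n, 'k) mpoly set"
  interpret R: cring "mpoly_ring :: ('n, 'k) mpoly ring"
    by (rule cring_from_type_algebra)
  show "ring (mpoly_ring :: ('n, 'k) mpoly ring)" by (rule R.ring_axioms)
  show "subgroup ?I (add_monoid mpoly_ring)"
  proof (rule R.add.subgroupI)
    show "?I \<noteq> {}" by (auto simp: supported_in_def intro: exI[of _ 0])
    show "\<ominus>\<^bsub>mpoly_ring\<^esub> f \<in> ?I" if "f \<in> ?I" for f
    proof -
      have "\<ominus>\<^bsub>mpoly_ring\<^esub> f = - f" by (rule R.minus_equality) auto
      then show ?thesis using supported_in_mult[OF U that, of "- 1"] by simp
    qed
  qed (auto intro: supported_in_add)
  show "g \<otimes>\<^bsub>mpoly_ring\<^esub> f \<in> ?I" "f \<otimes>\<^bsub>mpoly_ring\<^esub> g \<in> ?I" if "f \<in> ?I" for f g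
    using supported_in_mult[OF U that, of g] by (simp_all add: mult.commute)
qed

text \<open>
  A monomial is divisible by a squarefree one iff its support contains the support of the
  squarefree one. The supports of the monomials of \<open>I\<close> are therefore exactly the supersets of
  the supports of the generators.
\<close>

lemma squarefree_monomial_idealE:
  fixes I :: "('n, 'k::field) mpoly set"
  assumes "squarefree_monomial_ideal I"
  obtains U where "upset_in UNIV U" "I = supported_in U"
proof -
  obtain G where G: "G \<subseteq> squarefree_monomials" "I = genideal mpoly_ring G"
    using assms unfolding squarefree_monomial_ideal_def by blast
  interpret R: cring "mpoly_ring :: ('n, 'k) mpoly ring"
    by (rule cring_from_type_algebra)
  interpret ideal I mpoly_ring unfolding G(2) by (rule R.genideal_ideal) simp
  define U where "U = {C. \<exists>t. Poly_Mapping.single t (1::'k) \<in> G \<and> Poly_Mapping.keys t \<subseteq> C}"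
  have U: "upset_in UNIV U" unfolding upset_in_def U_def by blast
  have "I \<subseteq> supported_in U"
    unfolding G(2)
  proof (rule R.genideal_minimal[OF ideal_supported_in[OF U]])
    show "G \<subseteq> supported_in U"
      using G(1) unfolding supported_in_def U_def squarefree_monomials_def by fastforce
  qed
  moreover have "f \<in> I" if f: "f \<in> supported_in U" for f
  proof -
    have monomial: "Poly_Mapping.single t c \<in> I" if t: "Poly_Mapping.keys t \<in> U" for t c
    proof -
      obtain s where s: "Poly_Mapping.single s (1::'k) \<in> G" "Poly_Mapping.keys s \<subseteq> Poly_Mapping.keys t"
        using t unfolding U_def by blast
      obtain s' where s': "Poly_Mapping.single s (1::'k) = Poly_Mapping.single s' 1"
        "\<forall>i. Poly_Mapping.lookup s' i \<le> 1"
        using s(1) G(1) unfolding squarefree_monomials_def by blast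
      have "s = s'" using arg_cong[OF s'(1), of Poly_Mapping.keys] by simp
      then have "t - s + s = t" using exponent_diff_add s(2) s'(2) by blast
      then have "Poly_Mapping.single t c = Poly_Mapping.single (t - s) c * Poly_Mapping.single s 1"
        by (simp add: mult_single)
      moreover have "Poly_Mapping.single s 1 \<in> I"
        using s(1) R.genideal_self[of G] G(2) by auto
      ultimately show ?thesis using I_l_closed by simp
    qed
    have "(\<Sum>t\<in>T. Poly_Mapping.single t (Poly_Mapping.lookup f t)) \<in> I"
      if "finite T" "T \<subseteq> Poly_Mapping.keys f" for T
      using that
    proof (induction T rule: finite_induct)
      case empty
      then show ?case using additive_subgroup.zero_closed[OF is_additive_subgroup] by simp
    next
      case (insert t T)
      then show ?case
        using additive_subgroup.a_closed[OF is_additive_subgroup] f monomial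
        by (simp add: supported_in_def)
    qed
    from this[of "Poly_Mapping.keys f"] show ?thesis by (simp add: sum_terms)
  qed
  ultimately have "I = supported_in U" by blast
  then show ?thesis using that U by blast
qed

section \<open>A lower bound for the Stanley depth of the ideal\<close>

lemma finsum_ideal_module:
  fixes I :: "('n, 'k::field) mpoly set"
  assumes "ideal I mpoly_ring" "finite J" "\<And>j. j \<in> J \<Longrightarrow> v j \<in> I"
  shows "(\<Oplus>\<^bsub>ideal_module I\<^esub>j\<in>J. v j) = (\<Sum>j\<in>J. v j)"
proof -
  interpret M: Module.module mpoly_ring "ideal_module I"
    by (rule module_ideal_module[OF assms(1)])
  show ?thesis
    using assms(2,3)
  proof (induction J rule: finite_induct)
    case empty
    then show ?case using M.M.finsum_empty[of v] by (simp add: ideal_module_def)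
  next
    case (insert j J)
    then have "v \<in> J \<rightarrow> carrier (ideal_module I)" "v j \<in> carrier (ideal_module I)"
      by (auto simp: ideal_module_def)
    then have "(\<Oplus>\<^bsub>ideal_module I\<^esub>j\<in>insert j J. v j)
        = v j \<oplus>\<^bsub>ideal_module I\<^esub> (\<Oplus>\<^bsub>ideal_module I\<^esub>j\<in>J. v j)"
      using insert.hyps by (simp add: M.M.finsum_insert)
    then show ?case using insert by (simp add: ideal_module_def)
  qed
qed

text \<open>
  A monomial with support between \<open>A\<close> and \<open>B\<close> is \<open>x\<^sub>A\<close> times a monomial in the variables \<open>B\<close>, as
  all exponents of \<open>x\<^sub>A\<close> are at most one.
\<close>

lemma stanley_span_ideal_module:
  fixes I :: "('n::finite, 'k::field) mpoly set"
  assumes "A \<subseteq> B"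
  shows "stanley_span (ideal_module I) (Poly_Mapping.single (squarefree_exponent A) 1) B
    = supported_in {A..B}"
proof (intro equalityI subsetI)
  let ?e = "squarefree_exponent A"
  fix f assume "f \<in> stanley_span (ideal_module I) (Poly_Mapping.single ?e 1) B"
  then obtain g where g: "g \<in> polys_in B" "f = g * Poly_Mapping.single ?e 1"
    by (auto simp: stanley_span_def ideal_module_def)
  show "f \<in> supported_in {A..B}"
    unfolding supported_in_def
  proof safe
    fix t assume "t \<in> Poly_Mapping.keys f"
    then obtain s where "t = s + ?e" "s \<in> Poly_Mapping.keys g"
      using keys_mult[of g "Poly_Mapping.single ?e 1"] g(2) by auto
    then show "Poly_Mapping.keys t \<in> {A..B}"
      using g(1) assms by (auto simp: polys_in_def keys_exponent_add)
  qed
next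
  let ?e = "squarefree_exponent A"
  fix f :: "('n, 'k) mpoly" assume f: "f \<in> supported_in {A..B}"
  define g where "g = (\<Sum>t\<in>Poly_Mapping.keys f. Poly_Mapping.single (t - ?e) (Poly_Mapping.lookup f t))"
  have "g * Poly_Mapping.single ?e 1
    = (\<Sum>t\<in>Poly_Mapping.keys f. Poly_Mapping.single (t - ?e + ?e) (Poly_Mapping.lookup f t))"
    unfolding g_def by (simp add: sum_distrib_right mult_single)
  also have "\<dots> = (\<Sum>t\<in>Poly_Mapping.keys f. Poly_Mapping.single t (Poly_Mapping.lookup f t))"
  proof (rule sum.cong[OF refl])
    fix t assume "t \<in> Poly_Mapping.keys f"
    then have "t - ?e + ?e = t"
      using f by (intro exponent_diff_add) (auto simp: supported_in_def lookup_squarefree_exponent)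
    then show "Poly_Mapping.single (t - ?e + ?e) (Poly_Mapping.lookup f t)
      = Poly_Mapping.single t (Poly_Mapping.lookup f t)" by simp
  qed
  also have "\<dots> = f" by (rule sum_terms)
  finally have "f = g * Poly_Mapping.single ?e 1" ..
  moreover have "g \<in> polys_in B"
    unfolding polys_in_def
  proof safe
    fix s i assume "s \<in> Poly_Mapping.keys g" and i: "i \<in> Poly_Mapping.keys s"
    then obtain t where t: "t \<in> Poly_Mapping.keys f" "s = t - ?e"
      using keys_sum unfolding g_def by (fastforce split: if_splits)
    then have "i \<in> Poly_Mapping.keys t" using i by (auto simp: in_keys_iff lookup_minus)
    then show "i \<in> B" using t f unfolding supported_in_def by fastforce
  qed
  ultimately show "f \<in> stanley_span (ideal_module I) (Poly_Mapping.single ?e 1) B"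
    by (auto simp: stanley_span_def ideal_module_def)
qed

text \<open>
  The projection onto the span of the monomials with support in \<open>\<C>\<close>; for an interval, it is the
  component of a polynomial in the corresponding Stanley space.
\<close>

definition restrict_support :: "'n set set \<Rightarrow> ('n, 'k::field) mpoly \<Rightarrow> ('n, 'k) mpoly"
  where "restrict_support \<C> f =
    (\<Sum>t | t \<in> Poly_Mapping.keys f \<and> Poly_Mapping.keys t \<in> \<C>.
      Poly_Mapping.single t (Poly_Mapping.lookup f t))"

lemma lookup_restrict_support:
  "Poly_Mapping.lookup (restrict_support \<C> f) t
    = (if Poly_Mapping.keys t \<in> \<C> then Poly_Mapping.lookup f t else 0)"
  by (auto simp: restrict_support_def lookup_sum lookup_single when_def in_keys_iff)

lemma restrict_support_supported_in: "restrict_support \<C> f \<in> supported_in \<C>"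
  by (auto simp: supported_in_def in_keys_iff lookup_restrict_support split: if_splits)

lemma stanley_space_ideal_module:
  fixes U :: "'n::finite set set"
  assumes "A \<in> U"
  shows "stanley_space (ideal_module (supported_in U :: ('n, 'k::field) mpoly set))
    (Poly_Mapping.single (squarefree_exponent A) 1) B"
  unfolding stanley_space_def
proof (intro conjI ballI impI)
  let ?M = "ideal_module (supported_in U :: ('n, 'k) mpoly set)"
  let ?m = "Poly_Mapping.single (squarefree_exponent A) (1::'k)"
  show m: "?m \<in> carrier ?M" using assms by (simp add: ideal_module_def supported_in_def)
  have "?m \<in> component ?M (\<lambda>i. int (Poly_Mapping.lookup (squarefree_exponent A) i))"
    using m by (simp add: ideal_module_def poly_component_def)
  then show "homogeneous ?M ?m" unfolding homogeneous_def by blast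
  fix f assume "f \<odot>\<^bsub>?M\<^esub> ?m = \<zero>\<^bsub>?M\<^esub>"
  then have "f * ?m = 0" by (simp add: ideal_module_def)
  then show "f = 0"
    by (metis lookup_mult_monomial lookup_zero poly_mapping_eqI)
qed

text \<open>
  Disjoint intervals have disjoint sets of monomials, and these sets cover the monomials of the
  ideal, so that the Stanley spaces \<open>x\<^sub>A K[B]\<close> add up to a direct decomposition.
\<close>

lemma sdepth_ideal_ge:
  fixes U :: "'n::finite set set"
  assumes U: "upset_in UNIV U" and P: "interval_partition P U"
    and d: "\<forall>(A, B)\<in>P. d < card B"
  shows "enat (Suc d) \<le> sdepth (ideal_module (supported_in U :: ('n, 'k::field) mpoly set))"
proof -
  let ?M = "ideal_module (supported_in U :: ('n, 'k) mpoly set)"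
  obtain ps where ps: "set ps = P" "distinct ps"
    using finite_distinct_list[of P] by auto
  define C where "C j = {fst (ps ! j)..snd (ps ! j)}" for j
  have sub: "A \<subseteq> B" if "(A, B) \<in> P" for A B
    using P that unfolding interval_partition_def by blast
  have un: "(\<Union>j\<in>{..<length ps}. C j) = U"
  proof -
    have "(\<Union>j\<in>{..<length ps}. C j) = (\<Union>(A, B)\<in>P. {A..B})"
    proof -
      have "P = (!) ps ` {..<length ps}" using ps(1) by (auto simp: set_conv_nth)
      then show ?thesis by (simp add: C_def case_prod_beta)
    qed
    then show ?thesis using P unfolding interval_partition_def by simp
  qed
  have disj: "i = j" if "A \<in> C i" "A \<in> C j" "i < length ps" "j < length ps" for i j A
  proof (rule ccontr)
    assume "i \<noteq> j"
    then have "ps ! i \<noteq> ps ! j" "ps ! i \<in> P" "ps ! j \<in> P"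
      using that ps nth_eq_iff_index_eq by auto
    then show False using that P unfolding interval_partition_def C_def by blast
  qed
  define D where "D = map (\<lambda>(A, B). (Poly_Mapping.single (squarefree_exponent A) (1::'k), B)) ps"
  have span: "stanley_span ?M (fst (D ! j)) (snd (D ! j)) = supported_in (C j)"
    if "j < length ps" for j
  proof -
    obtain A B where AB: "ps ! j = (A, B)" by fastforce
    then have "A \<subseteq> B" using sub ps(1) that nth_mem by metis
    then show ?thesis
      using that AB by (simp add: D_def C_def stanley_span_ideal_module)
  qed
  have "stanley_decomposition ?M D"
    unfolding stanley_decomposition_def
  proof (intro conjI ballI)
    show "case x of (m, Z) \<Rightarrow> stanley_space ?M m Z" if x: "x \<in> set D" for x
    proof -
      obtain A B where AB: "(A, B) \<in> P" "x = (Poly_Mapping.single (squarefree_exponent A) 1, B)"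
        using x ps(1) unfolding D_def by auto
      have "A \<in> U"
        using AB(1) sub[OF AB(1)] P unfolding interval_partition_def by fastforce
      then show ?thesis using stanley_space_ideal_module AB(2) by auto
    qed
  next
    fix x assume "x \<in> carrier ?M"
    then have x: "x \<in> supported_in U" by (simp add: ideal_module_def)
    let ?Pi = "\<Pi>\<^sub>E j\<in>{..<length D}. stanley_span ?M (fst (D ! j)) (snd (D ! j))"
    have Pi: "?Pi = (\<Pi>\<^sub>E j\<in>{..<length ps}. supported_in (C j))"
    proof -
      have "length D = length ps" by (simp add: D_def)
      then show ?thesis by (simp only:) (rule PiE_cong, simp add: span)
    qed
    have fs: "(\<Oplus>\<^bsub>?M\<^esub>j\<in>{..<length D}. v j) = (\<Sum>j<length ps. v j)" if "v \<in> ?Pi" for v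
    proof -
      have "v j \<in> supported_in U" if "j \<in> {..<length D}" for j
        using PiE_mem[OF \<open>v \<in> ?Pi\<close>[unfolded Pi], of j] that un
        unfolding supported_in_def D_def by auto
      then have "(\<Oplus>\<^bsub>?M\<^esub>j\<in>{..<length D}. v j) = (\<Sum>j\<in>{..<length D}. v j)"
        by (intro finsum_ideal_module[OF ideal_supported_in[OF U]] finite_lessThan)
      then show ?thesis by (simp add: D_def)
    qed
    define w where "w = (\<lambda>j\<in>{..<length ps}. restrict_support (C j) x)"
    have w: "w \<in> ?Pi"
      unfolding Pi w_def by (auto simp: restrict_support_supported_in)
    have "x = (\<Sum>j<length ps. w j)"
    proof (rule poly_mapping_eqI)
      fix t
      have eq: "Poly_Mapping.lookup (\<Sum>j<length ps. w j) t
        = (\<Sum>j<length ps. if Poly_Mapping.keys t \<in> C j then Poly_Mapping.lookup x t else 0)"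
        by (auto simp: w_def lookup_sum lookup_restrict_support intro!: sum.cong)
      show "Poly_Mapping.lookup x t = Poly_Mapping.lookup (\<Sum>j<length ps. w j) t"
      proof (cases "Poly_Mapping.lookup x t = 0")
        case True
        then show ?thesis unfolding eq by (simp add: sum.neutral)
      next
        case False
        then have "Poly_Mapping.keys t \<in> U" using x by (auto simp: supported_in_def in_keys_iff)
        then obtain i where i: "i < length ps" "Poly_Mapping.keys t \<in> C i" using un by blast
        then have "(Poly_Mapping.keys t \<in> C j) = (j = i)" if "j < length ps" for j
          using disj that by blast
        then have "(\<Sum>j<length ps. if Poly_Mapping.keys t \<in> C j then Poly_Mapping.lookup x t else 0)
          = (\<Sum>j<length ps. if j = i then Poly_Mapping.lookup x t else 0)"
          by (intro sum.cong) auto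
        then show ?thesis unfolding eq using i(1) by simp
      qed
    qed
    then have ex: "w \<in> ?Pi \<and> x = (\<Oplus>\<^bsub>?M\<^esub>j\<in>{..<length D}. w j)" using w fs by simp
    show "\<exists>!v. v \<in> ?Pi \<and> x = (\<Oplus>\<^bsub>?M\<^esub>j\<in>{..<length D}. v j)"
    proof (rule ex1I, rule ex)
      fix v assume v: "v \<in> ?Pi \<and> x = (\<Oplus>\<^bsub>?M\<^esub>j\<in>{..<length D}. v j)"
      then have xv: "x = (\<Sum>j<length ps. v j)" using fs by blast
      have v': "v \<in> (\<Pi>\<^sub>E j\<in>{..<length ps}. supported_in (C j))" using v Pi by simp
      show "v = w"
      proof (rule ext)
        fix j
        show "v j = w j"
        proof (cases "j < length ps")
          case False
          then have "v j = undefined" by (intro PiE_arb[OF v']) simp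
          then show ?thesis using False by (simp add: w_def)
        next
          case j: True
          have vj: "v i \<in> supported_in (C i)" if "i < length ps" for i
            using PiE_mem[OF v', of i] that by simp
          have zero: "Poly_Mapping.lookup (v i) t = 0"
            if "Poly_Mapping.keys t \<notin> C i" "i < length ps" for i t
            using vj[OF that(2)] that(1) unfolding supported_in_def by (auto simp: in_keys_iff)
          have "Poly_Mapping.lookup x t = Poly_Mapping.lookup (v j) t"
            if t: "Poly_Mapping.keys t \<in> C j" for t
          proof -
            have "Poly_Mapping.lookup x t
              = (\<Sum>i<length ps. if i = j then Poly_Mapping.lookup (v j) t else 0)"
              unfolding xv lookup_sum
            proof (rule sum.cong[OF refl])
              fix i assume "i \<in> {..<length ps}"
              then have "Poly_Mapping.keys t \<notin> C i" if "i \<noteq> j" using disj[OF _ t _ j] that by blast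
              then show "Poly_Mapping.lookup (v i) t = (if i = j then Poly_Mapping.lookup (v j) t else 0)"
                using zero \<open>i \<in> {..<length ps}\<close> by simp
            qed
            then show ?thesis using j by simp
          qed
          then show ?thesis
            using zero[OF _ j] j by (intro poly_mapping_eqI) (simp add: w_def lookup_restrict_support)
        qed
      qed
    qed
  qed
  moreover have "enat (Suc d) \<le> sdepth_decomposition D"
    unfolding sdepth_decomposition_def
  proof (rule INF_greatest)
    fix x assume "x \<in> set D"
    then obtain A B where "(A, B) \<in> P" "snd x = B" unfolding D_def using ps(1) by auto
    then have "Suc d \<le> card (snd x)" using d by (auto simp: Suc_le_eq)
    then show "enat (Suc d) \<le> (case x of (m, Z) \<Rightarrow> enat (card Z))" by (simp add: case_prod_beta)
  qed
  ultimately show ?thesis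
    unfolding sdepth_def by (intro SUP_upper2[of D]) simp_all
qed

text \<open>
  In every Stanley decomposition some space contains a nonzero scalar multiple of the residue class
  of \<open>x\<^sub>F\<close>, and freeness forces its variables to lie in the facet \<open>F\<close>.
\<close>

lemma sdepth_quotient_le:
  fixes U :: "'n::finite set set"
  assumes U: "upset_in UNIV U" and F: "F \<notin> U"
    and facet: "\<And>F'. F \<subseteq> F' \<Longrightarrow> F' \<notin> U \<Longrightarrow> F' = F"
  shows "sdepth (quotient_module (supported_in U :: ('n, 'k::field) mpoly set)) \<le> enat (card F)"
  unfolding sdepth_def
proof (rule SUP_least, unfold mem_Collect_eq)
  let ?I = "supported_in U :: ('n, 'k) mpoly set"
  let ?M = "quotient_module ?I"
  let ?R = "mpoly_ring :: ('n, 'k) mpoly ring"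
  fix D assume D: "stanley_decomposition ?M D"
  interpret ideal ?I ?R by (rule ideal_supported_in[OF U])
  interpret M: Module.module ?R ?M
    by (rule module_quotient_module[OF ideal_supported_in[OF U]])
  interpret h: ring_hom_ring ?R "?R Quot ?I" "(+>\<^bsub>?R\<^esub>) ?I"
    by (rule rcos_ring_hom_ring)
  let ?c = "\<lambda>f. ?I +>\<^bsub>?R\<^esub> f"
  have carr: "?c f \<in> carrier ?M" for f
    using h.hom_closed by (simp add: quotient_module_def Let_def)
  have smult: "f \<odot>\<^bsub>?M\<^esub> ?c g = ?c (f * g)" for f g
    using h.hom_mult[of f g] by (simp add: quotient_module_def Let_def)
  have cadd: "?c f \<oplus>\<^bsub>?M\<^esub> ?c g = ?c (f + g)" for f g
    using h.hom_add[of f g] by (simp add: quotient_module_def Let_def)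
  have czero: "\<zero>\<^bsub>?M\<^esub> = ?c 0"
    using h.hom_zero by (simp add: quotient_module_def Let_def)
  have ceq: "f - g \<in> ?I" if "?c f = ?c g" for f g
  proof -
    have "f \<in> ?c g" using that a_rcos_self[of f] by simp
    then show ?thesis by (auto simp: a_r_coset_def' )
  qed
  have cfinsum: "(\<Oplus>\<^bsub>?M\<^esub>j\<in>J. v j) = ?c (\<Sum>j\<in>J. g j)"
    if "finite J" "\<And>j. j \<in> J \<Longrightarrow> v j = ?c (g j)" for J :: "nat set" and v g
    using that
  proof (induction J rule: finite_induct)
    case empty
    then show ?case by (simp add: czero)
  next
    case (insert j J)
    have "v \<in> J \<rightarrow> carrier ?M" "v j \<in> carrier ?M" using insert.prems carr by auto
    then have "(\<Oplus>\<^bsub>?M\<^esub>j\<in>insert j J. v j) = v j \<oplus>\<^bsub>?M\<^esub> (\<Oplus>\<^bsub>?M\<^esub>j\<in>J. v j)"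
      using insert.hyps by (simp add: M.M.finsum_insert)
    then show ?case using insert cadd by simp
  qed
  \<comment> \<open>A generator is the class of a polynomial with at most one monomial \<open>t\<close>, and freeness, tested
    on the product of the variables in \<open>Z\<close>, makes \<open>Z\<close> and the support of \<open>t\<close> span a face.\<close>
  have rep: "\<exists>p t. m = ?c p \<and> Poly_Mapping.keys p \<subseteq> {t} \<and> Z \<union> Poly_Mapping.keys t \<notin> U"
    if mZ: "(m, Z) \<in> set D" for m Z
  proof -
    have space: "stanley_space ?M m Z" using D mZ unfolding stanley_decomposition_def by blast
    then obtain a where "m \<in> component ?M a"
      unfolding stanley_space_def homogeneous_def by blast
    then obtain p where p: "p \<in> poly_component a" "m = ?c p"
      by (auto simp: quotient_module_def Let_def)
    let ?x = "Poly_Mapping.single (squarefree_exponent Z) (1::'k)"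
    have "?x \<in> polys_in Z" by (simp add: polys_in_def)
    moreover have "?x \<noteq> 0"
    proof
      assume "?x = 0"
      then have "Poly_Mapping.keys ?x = {}" by (simp only: keys_zero)
      then show False by simp
    qed
    ultimately have "?x \<odot>\<^bsub>?M\<^esub> m \<noteq> \<zero>\<^bsub>?M\<^esub>" using space unfolding stanley_space_def by blast
    then have "?c (?x * p) \<noteq> \<zero>\<^bsub>?M\<^esub>" using p(2) smult by simp
    then have "?x * p \<notin> ?I"
      using a_rcos_const[of "?x * p"] by (auto simp: quotient_module_def Let_def FactRing_def)
    then obtain s where s: "s \<in> Poly_Mapping.keys (?x * p)" "Poly_Mapping.keys s \<notin> U"
      unfolding supported_in_def by blast
    then obtain t where t: "t \<in> Poly_Mapping.keys p" "s = squarefree_exponent Z + t"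
      using keys_mult[of ?x p] by auto
    have "t' = t" if "t' \<in> Poly_Mapping.keys p" for t'
      using p(1) that t(1) unfolding poly_component_def
      by (intro poly_mapping_eqI) (metis (mono_tags, lifting) mem_Collect_eq of_nat_eq_iff)
    then have "Poly_Mapping.keys p \<subseteq> {t}" by blast
    then show ?thesis using p(2) s(2) t(2) by (auto simp: keys_exponent_add)
  qed
  let ?e = "squarefree_exponent F"
  obtain v where v: "v \<in> (\<Pi>\<^sub>E j\<in>{..<length D}. stanley_span ?M (fst (D ! j)) (snd (D ! j)))"
    "?c (Poly_Mapping.single ?e 1) = (\<Oplus>\<^bsub>?M\<^esub>j\<in>{..<length D}. v j)"
    using ex1_implies_ex[OF bspec[OF conjunct2[OF D[unfolded stanley_decomposition_def]]
      carr[of "Poly_Mapping.single ?e 1"]]] by blast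
  \<comment> \<open>The exponents of a representative of \<open>v j\<close> are those of the generator, shifted by exponents
    of polynomials in the variables of the \<open>j\<close>-th space.\<close>
  have "\<exists>g. v j = ?c g \<and> (\<forall>s\<in>Poly_Mapping.keys g. \<exists>r t. s = r + t \<and>
      Poly_Mapping.keys r \<subseteq> snd (D ! j) \<and> snd (D ! j) \<union> Poly_Mapping.keys t \<notin> U)"
    if j: "j < length D" for j
  proof -
    obtain m Z where mZ: "D ! j = (m, Z)" by fastforce
    then have "(m, Z) \<in> set D" using j nth_mem by metis
    then obtain p t where p: "m = ?c p" "Poly_Mapping.keys p \<subseteq> {t}"
      "Z \<union> Poly_Mapping.keys t \<notin> U"
      using rep by blast
    have "v j \<in> stanley_span ?M m Z" using v(1) j mZ by (auto dest: PiE_mem)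
    then obtain f where f: "f \<in> polys_in Z" "v j = ?c (f * p)"
      unfolding stanley_span_def using smult p(1) by auto
    have "\<exists>r. s = r + t \<and> Poly_Mapping.keys r \<subseteq> Z" if "s \<in> Poly_Mapping.keys (f * p)" for s
      using keys_mult[of f p] that p(2) f(1) unfolding polys_in_def by blast
    then show ?thesis using f(2) p(3) mZ by auto
  qed
  then obtain g where g: "\<And>j. j < length D \<Longrightarrow> v j = ?c (g j)"
    "\<And>j s. j < length D \<Longrightarrow> s \<in> Poly_Mapping.keys (g j) \<Longrightarrow> \<exists>r t. s = r + t \<and>
      Poly_Mapping.keys r \<subseteq> snd (D ! j) \<and> snd (D ! j) \<union> Poly_Mapping.keys t \<notin> U"
    by metis
  have "?c (Poly_Mapping.single ?e 1) = ?c (\<Sum>j<length D. g j)"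
    using v(2) cfinsum[of "{..<length D}" v g] g(1) by simp
  then have "Poly_Mapping.single ?e 1 - (\<Sum>j<length D. g j) \<in> ?I" by (rule ceq)
  \<comment> \<open>Since \<open>F\<close> is a face, polynomials in the ideal have coefficient zero at \<open>x\<^sub>F\<close>.\<close>
  then have "Poly_Mapping.lookup (Poly_Mapping.single ?e 1 - (\<Sum>j<length D. g j)) ?e = 0"
    using F keys_squarefree_exponent[of F] unfolding supported_in_def mem_Collect_eq
    by (metis in_keys_iff)
  then have "(\<Sum>j<length D. Poly_Mapping.lookup (g j) ?e) = 1"
    by (simp add: lookup_minus lookup_sum)
  then obtain j where j: "j < length D" "Poly_Mapping.lookup (g j) ?e \<noteq> 0"
    by (metis lessThan_iff sum.neutral zero_neq_one)
  then obtain r t where rt: "?e = r + t" "Poly_Mapping.keys r \<subseteq> snd (D ! j)"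
    "snd (D ! j) \<union> Poly_Mapping.keys t \<notin> U"
    using g(2)[OF j(1), of ?e] by (auto simp: in_keys_iff)
  have "F = Poly_Mapping.keys r \<union> Poly_Mapping.keys t"
    using arg_cong[OF rt(1), of Poly_Mapping.keys] by (simp add: keys_exponent_add)
  then have "F \<subseteq> snd (D ! j) \<union> Poly_Mapping.keys t" using rt(2) by blast
  then have "snd (D ! j) \<subseteq> F" using facet rt(3) by blast
  then have "card (snd (D ! j)) \<le> card F" by (simp add: card_mono)
  moreover have "sdepth_decomposition D \<le> enat (card (snd (D ! j)))"
    unfolding sdepth_decomposition_def
    by (rule INF_lower2[of "D ! j"]) (use j in \<open>auto simp: case_prod_beta\<close>)
  ultimately show "sdepth_decomposition D \<le> enat (card F)"
    by (metis enat_ord_simps(1) order.trans)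
qed

section \<open>Comparison of the two Stanley depths\<close>

theorem theorem11:
  fixes I :: "(4, 'k::field) mpoly set"
  assumes "squarefree_monomial_ideal I"
    and "I \<noteq> UNIV"
  shows "sdepth (ideal_module I) > sdepth (quotient_module I)"
proof -
  obtain U where U: "upset_in UNIV U" "I = supported_in U"
    by (rule squarefree_monomial_idealE[OF assms(1)])
  have empty: "{} \<notin> U"
  proof
    assume "{} \<in> U"
    then have "C \<in> U" for C using upset_inD[OF U(1)] by blast
    then show False using assms(2) U(2) unfolding supported_in_def by blast
  qed
  define facet where "facet F \<longleftrightarrow> F \<notin> U \<and> (\<forall>F'. F \<subseteq> F' \<longrightarrow> F' \<notin> U \<longrightarrow> F' = F)" for F
  have ex: "\<exists>F'. F \<subseteq> F' \<and> facet F'" if "F \<notin> U" for F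
    using finite_has_maximal2[of "- U" F] that unfolding facet_def by auto
  then obtain F where F: "facet F" and min: "\<And>F'. facet F' \<Longrightarrow> card F \<le> card F'"
    using empty ex_has_least_nat[of facet _ card] by metis
  have "large_faces (card F) UNIV U"
    unfolding large_faces_def using ex min by (metis facet_def subset_UNIV)
  then obtain P where P: "interval_partition P U" "\<forall>(A, B)\<in>P. card F < card B"
    using interval_partition_four[of UNIV U] U(1) empty by auto
  have "sdepth (quotient_module I) \<le> enat (card F)"
    unfolding U(2) by (rule sdepth_quotient_le[OF U(1)]) (use F facet_def in auto)
  also have "\<dots> < enat (Suc (card F))" by simp
  also have "\<dots> \<le> sdepth (ideal_module I)"
    unfolding U(2) by (rule sdepth_ideal_ge[OF U(1) P])
  finally show ?thesis .
qed

end
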